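(* Let $(\mathscr{A},\langle\cdot,\cdot\rangle)$ be a finite-dimensional real metric Jordan algebra with orthonormal basis $\{E_i\}$. Then its Jordan scalar curvature is $$\mathrm{sc}=-\frac14\sum_{i,j,k}\langle E_iE_j,E_k\rangle^2+\frac12\sum_iB(E_i,E_i)-\frac14\langle H,H\rangle,$$ where $B$ is the Killing form of $\mathscr{A}$ and $H$ is the mean curvature vector. Consequently, if $\mathscr{A}$ is nilpotent, then $\mathrm{sc}\le 0$, with equality if and only if $\mathscr{A}$ is trivial, i.e. $XY=0$ for all $X,Y\in\mathscr{A}$.
   Context: A (real) Jordan algebra is a real vector space $\mathscr{A}$ with a bilinear product satisfying $XY=YX$ and $X(X^2Y)=X^2(XY)$. It is nilpotent if $\mathscr{A}^m=0$ for some $m$, where $\mathscr{A}^0=\mathscr{A}$, $\mathscr{A}^{k+1}=\mathscr{A}\mathscr{A}^k$ (span of products). A metric Jordan algebra is a Jordan algebra with an arbitrary (positive definite) inner product $\langle\cdot,\cdot\rangle$. Its Jordan-Levi-Civita connection is the unique bilinear map $(X,Y)\mapsto\nabla_XY$ with $\nabla_XY+\nabla_YX=XY$ and $\langle\nabla_XY,Z\rangle=\langle Y,\nabla_XZ\rangle$ for all $X,Y,Z$; explicitly $\langle\nabla_XY,Z\rangle=\frac12(\langle XY,Z\rangle-\langle YZ,X\rangle+\langle ZX,Y\rangle)$. The Jordan curvature tensor is $R(X,Y)Z=-\nabla_X\nabla_YZ-\nabla_Y\nabla_XZ+\nabla_{XY}Z$. Put $\operatorname{ric}(U,V)=\operatorname{Tr}(X\mapsto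 R(U,X)V)$ and $\operatorname{Ric}(U,V)=\frac12(\operatorname{ric}(U,V)+\operatorname{ric}(V,U))$. The Jordan scalar curvature is the trace of $\operatorname{Ric}$ with respect to $\langle\cdot,\cdot\rangle$, i.e. $\mathrm{sc}=\sum_i\operatorname{Ric}(E_i,E_i)$. With $L_X(Y)=XY$, the Killing form is $B(X,Y)=\operatorname{Tr}(L_XL_Y)$. The mean curvature vector is $H=\sum_iE_i^2$ for any orthonormal basis $\{E_i\}$. *)

theory Defs
  imports "HOL-Analysis.Analysis"
begin

text \<open>
  The underlying vector space is the universe of a type and the product is an explicit argument
  \<open>p\<close>. The inner product is that of the class \<open>real_inner\<close>, which, unlike \<open>euclidean_space\<close>, does
  not exclude dimension zero; it is not assumed to be related to the product in any way.
\<close>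

definition jordan_algebra :: "('a::real_vector \<Rightarrow> 'a \<Rightarrow> 'a) \<Rightarrow> bool" where
  "jordan_algebra p \<longleftrightarrow> bilinear p \<and> (\<forall>x y. p x y = p y x) \<and>
     (\<forall>x y. p x (p (p x x) y) = p (p x x) (p x y))"

primrec jordan_power :: "('a::real_vector \<Rightarrow> 'a \<Rightarrow> 'a) \<Rightarrow> nat \<Rightarrow> 'a set" where
  "jordan_power p 0 = UNIV"
| "jordan_power p (Suc k) = span {p x y | x y. y \<in> jordan_power p k}"

definition nilpotent_algebra :: "('a::real_vector \<Rightarrow> 'a \<Rightarrow> 'a) \<Rightarrow> bool" where
  "nilpotent_algebra p \<longleftrightarrow> (\<exists>k. jordan_power p k = {0})"

definition orthonormal_basis :: "'a::real_inner set \<Rightarrow> bool" where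
  "orthonormal_basis E \<longleftrightarrow> finite E \<and> pairwise orthogonal E \<and> (\<forall>e\<in>E. norm e = 1) \<and> span E = UNIV"

text \<open>
  Traces of endomorphisms and of bilinear forms are computed in a chosen basis, so that they do
  not carry the basis as an argument. They are meaningful only in finite dimension.
\<close>

definition linear_trace :: "('a::real_vector \<Rightarrow> 'a) \<Rightarrow> real" where
  "linear_trace f = (let B = (SOME B. independent B \<and> span B = UNIV)
                     in \<Sum>b\<in>B. representation B (f b) b)"

definition some_orthonormal_basis :: "'a::real_inner set" where
  "some_orthonormal_basis = (SOME E. orthonormal_basis E)"

definition metric_trace :: "('a::real_inner \<Rightarrow> 'a \<Rightarrow> real) \<Rightarrow> real" where
  "metric_trace b = (\<Sum>e\<in>some_orthonormal_basis. b e e)"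

definition is_jordan_connection ::
    "('a::real_inner \<Rightarrow> 'a \<Rightarrow> 'a) \<Rightarrow> ('a \<Rightarrow> 'a \<Rightarrow> 'a) \<Rightarrow> bool" where
  "is_jordan_connection p N \<longleftrightarrow> bilinear N \<and> (\<forall>x y. N x y + N y x = p x y) \<and>
     (\<forall>x y z. N x y \<bullet> z = y \<bullet> N x z)"

definition jordan_connection :: "('a::real_inner \<Rightarrow> 'a \<Rightarrow> 'a) \<Rightarrow> 'a \<Rightarrow> 'a \<Rightarrow> 'a" where
  "jordan_connection p = (THE N. is_jordan_connection p N)"

definition jordan_curvature :: "('a::real_inner \<Rightarrow> 'a \<Rightarrow> 'a) \<Rightarrow> 'a \<Rightarrow> 'a \<Rightarrow> 'a \<Rightarrow> 'a" where
  "jordan_curvature p x y z = (let N = jordan_connection p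
                               in - N x (N y z) - N y (N x z) + N (p x y) z)"

definition jordan_ric :: "('a::real_inner \<Rightarrow> 'a \<Rightarrow> 'a) \<Rightarrow> 'a \<Rightarrow> 'a \<Rightarrow> real" where
  "jordan_ric p u v = linear_trace (\<lambda>x. jordan_curvature p u x v)"

definition jordan_Ricci :: "('a::real_inner \<Rightarrow> 'a \<Rightarrow> 'a) \<Rightarrow> 'a \<Rightarrow> 'a \<Rightarrow> real" where
  "jordan_Ricci p u v = (jordan_ric p u v + jordan_ric p v u) / 2"

definition jordan_scalar_curvature :: "('a::real_inner \<Rightarrow> 'a \<Rightarrow> 'a) \<Rightarrow> real" where
  "jordan_scalar_curvature p = metric_trace (jordan_Ricci p)"

definition killing_form :: "('a::real_vector \<Rightarrow> 'a \<Rightarrow> 'a) \<Rightarrow> 'a \<Rightarrow> 'a \<Rightarrow> real" where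
  "killing_form p x y = linear_trace (p x \<circ> p y)"

definition mean_curvature :: "('a::real_inner \<Rightarrow> 'a \<Rightarrow> 'a) \<Rightarrow> 'a" where
  "mean_curvature p = (\<Sum>e\<in>some_orthonormal_basis. p e e)"

end

theory Submission
  imports Defs
begin

text \<open>
  Write \<open>c i j k = p i j \<bullet> k\<close> for the structure constants in an orthonormal basis. The Koszul-type
  formula \<open>is_jordan_connection_inner\<close> expresses the connection \<open>N\<close> by the \<open>c i j k\<close>, and the scalar
  curvature is the sum over basis vectors \<open>i, j\<close> of

  \<open>- N i (N j i) \<bullet> j - N j (N i i) \<bullet> j + N (p i j) i \<bullet> j\<close>.

  Let \<open>a\<close> be the sum of the squares of the \<open>c i j k\<close>, \<open>b\<close> the sum of the values \<open>B(i, i)\<close> of the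
  Killing form, and \<open>H\<close> the mean curvature vector. Every \<open>N x\<close> is self-adjoint, which in the first
  two terms moves the outer connection to the other side of the inner product; to the third the
  formula for \<open>N\<close> applies directly. The three sums become
  \<open>- (2 b - a)/4\<close> (Parseval and the cyclic symmetry of the index sum), \<open>- (H \<bullet> H)/4\<close> (because
  \<open>N i i\<close> is half of \<open>p i i\<close>) and \<open>b - a/2\<close>; these add up to the formula.

  If the algebra is nilpotent, then multiplication by \<open>x\<close> pushes each power of the algebra into the
  next one, so its square has trace zero in a basis adapted to these powers and \<open>b\<close> vanishes. What
  remains is minus a sum of squares, which is zero only if all structure constants are zero.

  The traces are defined by unspecified bases. The lemmas \<open>sum_basis_representation\<close> and
  \<open>sum_bilinear_orthonormal\<close> allow each of them to be computed in the basis that suits the argument.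
\<close>

section \<open>Orthonormal bases\<close>

lemma orthonormal_basis_inner:
  assumes "orthonormal_basis E" "x \<in> E" "y \<in> E"
  shows "x \<bullet> y = (if x = y then 1 else 0)"
  using assms
  by (auto simp: orthonormal_basis_def pairwise_def orthogonal_def norm_eq_1)

lemma orthonormal_basis_expand:
  assumes E: "orthonormal_basis E"
  shows "(\<Sum>e\<in>E. (x \<bullet> e) *\<^sub>R e) = x"
proof -
  have fin: "finite E" and sp: "x \<in> span E"
    using E by (auto simp: orthonormal_basis_def)
  obtain u where x: "x = (\<Sum>e\<in>E. u e *\<^sub>R e)"
    using sp fin by (auto simp: span_finite)
  have "x \<bullet> e = u e" if "e \<in> E" for e
  proof -
    have "x \<bullet> e = (\<Sum>d\<in>E. if d = e then u d else 0)"
      unfolding x inner_sum_left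
      by (rule sum.cong) (simp_all add: orthonormal_basis_inner[OF E _ that])
    then show ?thesis using fin that by simp
  qed
  then show ?thesis by (simp add: x)
qed

lemma orthonormal_basis_parseval:
  assumes E: "orthonormal_basis E"
  shows "(\<Sum>e\<in>E. (x \<bullet> e) * (y \<bullet> e)) = x \<bullet> y"
proof -
  have "x \<bullet> y = (\<Sum>e\<in>E. (x \<bullet> e) *\<^sub>R e) \<bullet> y"
    by (simp only: orthonormal_basis_expand[OF E])
  also have "\<dots> = (\<Sum>e\<in>E. (x \<bullet> e) * (e \<bullet> y))"
    by (simp only: inner_sum_left inner_scaleR_left)
  finally show ?thesis by (simp add: inner_commute)
qed

lemma orthonormal_basis_some:
  fixes E :: "'a::real_inner set"
  assumes "orthonormal_basis E"
  shows "orthonormal_basis (some_orthonormal_basis :: 'a set)"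
  unfolding some_orthonormal_basis_def using assms by (rule someI)

section \<open>Traces do not depend on the basis\<close>

text \<open>
  The matrix \<open>e \<bullet> d\<close> that changes one orthonormal basis into another is orthogonal, so a sum over
  the diagonal is preserved. The values may lie in any vector space, so that the mean curvature
  vector is covered along with traces of forms.
\<close>

lemma sum_bilinear_orthonormal:
  fixes b :: "'a::real_inner \<Rightarrow> 'a \<Rightarrow> 'b::real_vector"
  assumes b: "bilinear b" and E: "orthonormal_basis E" and F: "orthonormal_basis F"
  shows "(\<Sum>e\<in>E. b e e) = (\<Sum>f\<in>F. b f f)"
proof -
  have l: "linear (\<lambda>x. b x y)" and r: "linear (b x)" for x y
    using b by (auto simp: bilinear_def)
  have "(\<Sum>e\<in>E. b e e) = (\<Sum>e\<in>E. \<Sum>f\<in>F. (e \<bullet> f) *\<^sub>R b f e)"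
  proof (rule sum.cong[OF refl])
    fix e
    have "b e e = b (\<Sum>f\<in>F. (e \<bullet> f) *\<^sub>R f) e"
      by (simp add: orthonormal_basis_expand[OF F])
    also have "\<dots> = (\<Sum>f\<in>F. (e \<bullet> f) *\<^sub>R b f e)"
      by (simp add: linear_sum[OF l] linear_scale[OF l])
    finally show "b e e = \<dots>" .
  qed
  also have "\<dots> = (\<Sum>f\<in>F. \<Sum>e\<in>E. (f \<bullet> e) *\<^sub>R b f e)"
    by (subst sum.swap) (simp add: inner_commute)
  also have "\<dots> = (\<Sum>f\<in>F. b f (\<Sum>e\<in>E. (f \<bullet> e) *\<^sub>R e))"
    by (simp add: linear_sum[OF r] linear_scale[OF r])
  also have "\<dots> = (\<Sum>f\<in>F. b f f)"
    by (simp add: orthonormal_basis_expand[OF E])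
  finally show ?thesis .
qed

text \<open>
  Expanding both \<open>e\<close> in the basis \<open>B\<close> and \<open>f b\<close> in the basis \<open>E\<close> turns either side into the same
  double sum.
\<close>

lemma sum_basis_representation:
  fixes f :: "'a::real_inner \<Rightarrow> 'a"
  assumes E: "orthonormal_basis E" and f: "linear f"
    and B: "independent B" "span B = UNIV"
  shows "(\<Sum>b\<in>B. representation B (f b) b) = (\<Sum>e\<in>E. f e \<bullet> e)"
proof -
  have fin: "finite B"
    using independent_span_bound[of E B] E B by (auto simp: orthonormal_basis_def)
  have rep: "(\<Sum>b\<in>B. representation B x b *\<^sub>R b) = x" for x
    using sum_representation_eq[of B x B] B fin by auto
  have lin: "representation B (\<Sum>e\<in>E. c e *\<^sub>R e) b = (\<Sum>e\<in>E. c e * representation B e b)" for c b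
    using B by (simp add: representation_sum representation_scale)
  have "(\<Sum>e\<in>E. f e \<bullet> e) = (\<Sum>e\<in>E. \<Sum>b\<in>B. representation B e b * (f b \<bullet> e))"
  proof (rule sum.cong[OF refl])
    fix e
    have "f e \<bullet> e = f (\<Sum>b\<in>B. representation B e b *\<^sub>R b) \<bullet> e"
      by (simp add: rep)
    also have "\<dots> = (\<Sum>b\<in>B. representation B e b * (f b \<bullet> e))"
      by (simp add: linear_sum[OF f] linear_scale[OF f] inner_sum_left)
    finally show "f e \<bullet> e = \<dots>" .
  qed
  also have "\<dots> = (\<Sum>b\<in>B. \<Sum>e\<in>E. (f b \<bullet> e) * representation B e b)"
    by (subst sum.swap) (simp add: mult.commute)
  also have "\<dots> = (\<Sum>b\<in>B. representation B (\<Sum>e\<in>E. (f b \<bullet> e) *\<^sub>R e) b)"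
    by (simp only: lin)
  also have "\<dots> = (\<Sum>b\<in>B. representation B (f b) b)"
    by (simp add: orthonormal_basis_expand[OF E])
  finally show ?thesis by simp
qed

lemma linear_trace_orthonormal:
  fixes f :: "'a::real_inner \<Rightarrow> 'a"
  assumes "orthonormal_basis E" "linear f"
  shows "linear_trace f = (\<Sum>e\<in>E. f e \<bullet> e)"
proof -
  obtain B where "independent B" "span B = (UNIV :: 'a set)"
    using maximal_independent_subset[of "UNIV :: 'a set"] by (metis top.extremum_uniqueI)
  then have "\<exists>B :: 'a set. independent B \<and> span B = UNIV"
    by blast
  from someI_ex[OF this] show ?thesis
    unfolding linear_trace_def Let_def using sum_basis_representation[OF assms] by blast
qed

section \<open>Endomorphisms that descend a filtration\<close>

text \<open>
  Extending a basis of each subspace of the filtration to a basis of the next larger one makes \<open>f\<close>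
  strictly triangular: \<open>f\<close> sends every newly added vector into the span of the old ones.
\<close>

lemma filtration_basis:
  fixes f :: "'a::real_vector \<Rightarrow> 'a" and V :: "nat \<Rightarrow> 'a set"
  assumes sub: "\<And>i. subspace (V i)" and dec: "\<And>i. V (Suc i) \<subseteq> V i"
    and f: "\<And>i x. x \<in> V i \<Longrightarrow> f x \<in> V (Suc i)" and zero: "V k = {0}"
  obtains B where "independent B" "span B = V 0" "\<And>b. b \<in> B \<Longrightarrow> representation B (f b) b = 0"
proof -
  have "\<exists>B. independent B \<and> span B = V 0 \<and> (\<forall>b\<in>B. representation B (f b) b = 0)"
  proof (rule inc_induct[of 0 k])
    show "\<exists>B. independent B \<and> span B = V k \<and> (\<forall>b\<in>B. representation B (f b) b = 0)"
      by (rule exI[of _ "{}"]) (simp add: zero independent_empty)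
  next
    fix n
    assume "\<exists>B. independent B \<and> span B = V (Suc n) \<and> (\<forall>b\<in>B. representation B (f b) b = 0)"
    then obtain B where B: "independent B" "span B = V (Suc n)"
      and B0: "\<And>b. b \<in> B \<Longrightarrow> representation B (f b) b = 0" by blast
    have "B \<subseteq> V n"
      using span_superset[of B] B(2) dec by blast
    then obtain C where C: "B \<subseteq> C" "C \<subseteq> V n" "independent C" "V n \<subseteq> span C"
      using maximal_independent_subset_extend[of B "V n"] B(1) by blast
    have spC: "span C = V n"
      using C(2,4) span_minimal[OF C(2) sub] by auto
    have "representation C (f b) b = 0" if "b \<in> C" for b
    proof -
      have "f b \<in> span B"
        using f[of b n] that C(2) B(2) by auto
      then have "representation C (f b) b = representation B (f b) b"
        using representation_extend[OF C(3) _ C(1)] by simp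
      also have "\<dots> = 0"
        using B0[of b] representation_ne_zero[of B "f b" b] by blast
      finally show ?thesis .
    qed
    with C(3) spC show "\<exists>B. independent B \<and> span B = V n \<and> (\<forall>b\<in>B. representation B (f b) b = 0)"
      by blast
  qed simp
  with that show thesis by blast
qed

lemma jordan_power_subspace: "subspace (jordan_power p i)"
  by (cases i) simp_all

lemma jordan_power_product: "y \<in> jordan_power p k \<Longrightarrow> p x y \<in> jordan_power p (Suc k)"
  by (auto intro!: span_base)

lemma jordan_power_decreasing: "jordan_power p (Suc k) \<subseteq> jordan_power p k"
proof (induction k)
  case (Suc k)
  then show ?case
    unfolding jordan_power.simps(2)[of p "Suc k"] jordan_power.simps(2)[of p k]
    by (intro span_mono) auto
qed simp

lemma killing_form_nilpotent:
  fixes p :: "'a::real_inner \<Rightarrow> 'a \<Rightarrow> 'a" and E :: "'a set"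
  assumes E: "orthonormal_basis E" and p: "bilinear p" and nil: "nilpotent_algebra p"
  shows "killing_form p x x = 0"
proof -
  obtain k where k: "jordan_power p k = {0}"
    using nil by (auto simp: nilpotent_algebra_def)
  have lin: "linear (p x \<circ> p x)"
    using p by (auto simp: bilinear_def intro: linear_compose)
  have "(p x \<circ> p x) y \<in> jordan_power p (Suc i)" if "y \<in> jordan_power p i" for i y
    using jordan_power_product[OF jordan_power_product[OF that]] jordan_power_decreasing
    unfolding o_def by blast
  then obtain B where B: "independent B" "span B = jordan_power p 0"
    and B0: "\<And>b. b \<in> B \<Longrightarrow> representation B ((p x \<circ> p x) b) b = 0"
    using filtration_basis[of "jordan_power p" "p x \<circ> p x" k]
      jordan_power_subspace jordan_power_decreasing k by metis
  have "killing_form p x x = (\<Sum>b\<in>B. representation B ((p x \<circ> p x) b) b)"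
    unfolding killing_form_def
    using sum_basis_representation[OF E lin B(1)] B(2) linear_trace_orthonormal[OF E lin] by simp
  with B0 show ?thesis by simp
qed

section \<open>The connection\<close>

text \<open>Alternating between the two defining properties solves for \<open>N\<close>, as in Riemannian geometry.\<close>

lemma is_jordan_connection_inner:
  assumes N: "is_jordan_connection p N"
  shows "N x y \<bullet> z = (p x y \<bullet> z - p y z \<bullet> x + p z x \<bullet> y) / 2"
proof -
  have s: "p a b = N a b + N b a" and a: "N a b \<bullet> c = N a c \<bullet> b" for a b c
    using N by (auto simp: is_jordan_connection_def inner_commute)
  show ?thesis
    unfolding s inner_add_left
    using a[of x y z] a[of y z x] a[of z x y] by simp
qed

text \<open>
  The formula of \<open>is_jordan_connection_inner\<close> gives uniqueness at once. It also gives existence: its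
  right-hand side is linear in \<open>z\<close>, hence is the inner product of \<open>z\<close> with the vector whose
  coordinates in \<open>E\<close> are the values at the basis vectors.
\<close>

lemma is_jordan_connection_jordan_connection:
  fixes p :: "'a::real_inner \<Rightarrow> 'a \<Rightarrow> 'a" and E :: "'a set"
  assumes E: "orthonormal_basis E" and p: "bilinear p" and comm: "\<And>x y. p x y = p y x"
  shows "is_jordan_connection p (jordan_connection p)"
  unfolding jordan_connection_def
proof (rule theI'[where P = "is_jordan_connection p"])
  have pl: "linear (\<lambda>x. p x y)" and pr: "linear (p x)" for x y
    using p by (auto simp: bilinear_def)
  define N where "N x y = (\<Sum>e\<in>E. ((p x y \<bullet> e - p y e \<bullet> x + p e x \<bullet> y) / 2) *\<^sub>R e)" for x y
  have inner: "N x y \<bullet> z = (p x y \<bullet> z - p y z \<bullet> x + p z x \<bullet> y) / 2" for x y z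
  proof -
    have "p y z = (\<Sum>e\<in>E. (z \<bullet> e) *\<^sub>R p y e)" "p z x = (\<Sum>e\<in>E. (z \<bullet> e) *\<^sub>R p e x)"
      using linear_sum[OF pr, of y "\<lambda>e. (z \<bullet> e) *\<^sub>R e" E]
        linear_sum[OF pl, of "\<lambda>e. (z \<bullet> e) *\<^sub>R e" E x]
      by (simp_all add: linear_scale[OF pr] linear_scale[OF pl] orthonormal_basis_expand[OF E])
    then have yz: "p y z \<bullet> x = (\<Sum>e\<in>E. (z \<bullet> e) * (p y e \<bullet> x))"
      and zx: "p z x \<bullet> y = (\<Sum>e\<in>E. (z \<bullet> e) * (p e x \<bullet> y))"
      by (simp_all add: inner_sum_left)
    have xy: "p x y \<bullet> z = (\<Sum>e\<in>E. (z \<bullet> e) * (p x y \<bullet> e))"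
      by (subst inner_commute) (rule orthonormal_basis_parseval[OF E, symmetric])
    have "N x y \<bullet> z = (\<Sum>e\<in>E. ((p x y \<bullet> e - p y e \<bullet> x + p e x \<bullet> y) / 2) * (z \<bullet> e))"
      unfolding N_def by (simp only: inner_sum_left inner_scaleR_left inner_commute[of z])
    also have "\<dots> = (p x y \<bullet> z - p y z \<bullet> x + p z x \<bullet> y) / 2"
      unfolding xy yz zx sum_subtractf[symmetric] sum.distrib[symmetric] sum_divide_distrib
      by (rule sum.cong) (simp_all add: field_simps)
    finally show ?thesis .
  qed
  have eqI: "v = w" if "\<And>z. v \<bullet> z = w \<bullet> z" for v w :: 'a
    using that vector_eq_rdot by blast
  have "bilinear N"
    unfolding bilinear_def
    by (intro allI conjI linearI; rule eqI)
      (simp_all add: inner inner_simps field_simps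
        linear_add[OF pl] linear_scale[OF pl] linear_add[OF pr] linear_scale[OF pr])
  moreover have "N x y + N y x = p x y" for x y
  proof (rule eqI)
    fix z
    show "(N x y + N y x) \<bullet> z = p x y \<bullet> z"
      unfolding inner_add_left inner comm[of y x] comm[of z x] comm[of z y]
      by (simp add: field_simps)
  qed
  moreover have "N x y \<bullet> z = y \<bullet> N x z" for x y z
    by (subst inner_commute[of y])
      (simp add: inner comm[of z y] comm[of y x] comm[of z x])
  ultimately have conn: "is_jordan_connection p N"
    by (simp add: is_jordan_connection_def)
  show "\<exists>!N. is_jordan_connection p N"
  proof (rule ex1I)
    show "is_jordan_connection p N" by (rule conn)
  next
    fix M assume "is_jordan_connection p M"
    then show "M = N"
      by (intro ext eqI) (simp add: is_jordan_connection_inner inner)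
  qed
qed

section \<open>The scalar curvature\<close>

lemma jordan_ric_orthonormal:
  fixes p :: "'a::real_inner \<Rightarrow> 'a \<Rightarrow> 'a" and E :: "'a set"
  assumes E: "orthonormal_basis E" and p: "bilinear p"
    and N: "is_jordan_connection p (jordan_connection p)"
  shows "jordan_ric p u v = (\<Sum>e\<in>E. jordan_curvature p u e v \<bullet> e)"
    and "bilinear (jordan_ric p)"
proof -
  have pl: "linear (\<lambda>x. p x y)" and pr: "linear (p x)" for x y
    using p by (auto simp: bilinear_def)
  have Nl: "linear (\<lambda>x. jordan_connection p x y)" and Nr: "linear (jordan_connection p x)" for x y
    using N by (auto simp: is_jordan_connection_def bilinear_def)
  note lin = linear_add[OF pl] linear_scale[OF pl] linear_add[OF pr] linear_scale[OF pr]
    linear_add[OF Nl] linear_scale[OF Nl] linear_add[OF Nr] linear_scale[OF Nr]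
  have R: "linear (\<lambda>x. jordan_curvature p x y z)" "linear (\<lambda>x. jordan_curvature p y x z)"
    "linear (jordan_curvature p y z)" for y z
    by (intro linearI; simp add: jordan_curvature_def Let_def lin algebra_simps)+
  show ric: "jordan_ric p u v = (\<Sum>e\<in>E. jordan_curvature p u e v \<bullet> e)" for u v
    unfolding jordan_ric_def by (rule linear_trace_orthonormal[OF E R(2)])
  show "bilinear (jordan_ric p)"
    unfolding bilinear_def
    by (intro allI conjI linearI)
      (simp_all add: ric inner_simps sum.distrib sum_distrib_left
        linear_add[OF R(1)] linear_scale[OF R(1)] linear_add[OF R(3)] linear_scale[OF R(3)])
qed

lemma sum_rotate:
  "(\<Sum>i\<in>E. \<Sum>j\<in>E. \<Sum>k\<in>E. g j k i) = (\<Sum>i\<in>E. \<Sum>j\<in>E. \<Sum>k\<in>E. g i j k)"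
proof -
  have "(\<Sum>i\<in>E. \<Sum>j\<in>E. \<Sum>k\<in>E. g j k i) = (\<Sum>j\<in>E. \<Sum>i\<in>E. \<Sum>k\<in>E. g j k i)"
    by (rule sum.swap)
  also have "\<dots> = (\<Sum>j\<in>E. \<Sum>k\<in>E. \<Sum>i\<in>E. g j k i)"
    by (rule sum.cong[OF refl], rule sum.swap)
  finally show ?thesis .
qed

lemma jordan_scalar_curvature_formula:
  fixes p :: "'a::real_inner \<Rightarrow> 'a \<Rightarrow> 'a" and E :: "'a set"
  assumes E: "orthonormal_basis E" and p: "bilinear p" and comm: "\<And>x y. p x y = p y x"
  shows "jordan_scalar_curvature p =
           - (1/4) * (\<Sum>i\<in>E. \<Sum>j\<in>E. \<Sum>k\<in>E. (p i j \<bullet> k)\<^sup>2)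
           + (1/2) * (\<Sum>i\<in>E. killing_form p i i)
           - (1/4) * (mean_curvature p \<bullet> mean_curvature p)"
proof -
  define N where "N = jordan_connection p"
  have conn: "is_jordan_connection p (jordan_connection p)"
    by (rule is_jordan_connection_jordan_connection[OF E p comm])
  have N: "is_jordan_connection p N"
    using conn by (simp add: N_def)
  have adj: "N x y \<bullet> z = y \<bullet> N x z" and sym: "N x y + N y x = p x y" for x y z
    using N by (auto simp: is_jordan_connection_def)
  note inner = is_jordan_connection_inner[OF N]
  define a where "a = (\<Sum>i\<in>E. \<Sum>j\<in>E. \<Sum>k\<in>E. (p i j \<bullet> k)\<^sup>2)"
  define b where "b = (\<Sum>i\<in>E. killing_form p i i)"
  define H :: 'a where "H = (\<Sum>i\<in>E. p i i)"

  have H: "mean_curvature p = H"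
    unfolding mean_curvature_def H_def
    by (rule sum_bilinear_orthonormal[OF p orthonormal_basis_some[OF E] E])
  have b: "b = (\<Sum>i\<in>E. \<Sum>j\<in>E. p i (p i j) \<bullet> j)"
  proof -
    have "linear (p i \<circ> p i)" for i
      using p by (auto simp: bilinear_def intro: linear_compose)
    then show ?thesis
      unfolding b_def killing_form_def
      by (simp add: linear_trace_orthonormal[OF E])
  qed
  have a2: "a = (\<Sum>i\<in>E. \<Sum>j\<in>E. p i j \<bullet> p i j)"
    unfolding a_def power2_eq_square by (simp only: orthonormal_basis_parseval[OF E])
  have b2: "b = (\<Sum>i\<in>E. \<Sum>j\<in>E. p j (p j i) \<bullet> i)"
    unfolding b by (rule sum.swap)

  have "jordan_scalar_curvature p = (\<Sum>u\<in>some_orthonormal_basis. jordan_ric p u u)"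
    by (simp add: jordan_scalar_curvature_def metric_trace_def jordan_Ricci_def)
  also have "\<dots> = (\<Sum>i\<in>E. jordan_ric p i i)"
    by (rule sum_bilinear_orthonormal[OF jordan_ric_orthonormal(2)[OF E p conn]
          orthonormal_basis_some[OF E] E])
  also have "\<dots> = (\<Sum>i\<in>E. \<Sum>j\<in>E. - (N i (N j i) \<bullet> j) - N j (N i i) \<bullet> j + N (p i j) i \<bullet> j)"
    by (simp add: jordan_ric_orthonormal(1)[OF E p conn] jordan_curvature_def
        inner_simps flip: N_def)
  also have "\<dots> = - (\<Sum>i\<in>E. \<Sum>j\<in>E. N i (N j i) \<bullet> j) - (\<Sum>i\<in>E. \<Sum>j\<in>E. N j (N i i) \<bullet> j)
      + (\<Sum>i\<in>E. \<Sum>j\<in>E. N (p i j) i \<bullet> j)"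
    by (simp add: sum.distrib sum_subtractf sum_negf)
  also have "(\<Sum>i\<in>E. \<Sum>j\<in>E. N i (N j i) \<bullet> j) = (2 * b - a) / 4"
  proof -
    \<comment> \<open>Summing over the index that the two factors share turns a product of structure constants
      into a diagonal entry of a squared multiplication operator.\<close>
    have cross: "(\<Sum>i\<in>E. (p j k \<bullet> i) * (p k i \<bullet> j)) = p k (p k j) \<bullet> j" for j k
    proof -
      have r: "linear (p k)" using p by (auto simp: bilinear_def)
      have "p k (p k j) \<bullet> j = p k (\<Sum>i\<in>E. (p j k \<bullet> i) *\<^sub>R i) \<bullet> j"
        by (simp add: orthonormal_basis_expand[OF E] comm[of j k])
      then show ?thesis
        by (simp add: linear_sum[OF r] linear_scale[OF r] inner_sum_left)
    qed
    have "N i (N j i) \<bullet> j = (\<Sum>k\<in>E. (N j i \<bullet> k) * (N i j \<bullet> k))" for i j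
      by (simp only: orthonormal_basis_parseval[OF E]) (rule adj)
    \<comment> \<open>With \<open>u, v, w\<close> the structure constants of \<open>i j k\<close>, \<open>j k i\<close>, \<open>k i j\<close>, the product is
      \<open>(u + v - w) (u - v + w) / 4 = (u\<^sup>2 - (v - w)\<^sup>2) / 4\<close>.\<close>
    moreover have "(N j i \<bullet> k) * (N i j \<bullet> k) =
        ((p i j \<bullet> k)\<^sup>2 - (p j k \<bullet> i)\<^sup>2 - (p k i \<bullet> j)\<^sup>2 + 2 * ((p j k \<bullet> i) * (p k i \<bullet> j))) / 4"
      for i j k
      unfolding inner comm[of j i] comm[of i k] comm[of k j]
      by (simp add: power2_eq_square algebra_simps)
    ultimately have "(\<Sum>i\<in>E. \<Sum>j\<in>E. N i (N j i) \<bullet> j) =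
        (a - (\<Sum>i\<in>E. \<Sum>j\<in>E. \<Sum>k\<in>E. (p j k \<bullet> i)\<^sup>2) - (\<Sum>i\<in>E. \<Sum>j\<in>E. \<Sum>k\<in>E. (p k i \<bullet> j)\<^sup>2)
          + 2 * (\<Sum>i\<in>E. \<Sum>j\<in>E. \<Sum>k\<in>E. (p j k \<bullet> i) * (p k i \<bullet> j))) / 4"
      by (simp only: a_def sum.distrib sum_subtractf flip: sum_divide_distrib sum_distrib_left)
    also have "(\<Sum>i\<in>E. \<Sum>j\<in>E. \<Sum>k\<in>E. (p j k \<bullet> i)\<^sup>2) = a"
      unfolding a_def by (rule sum_rotate)
    also have "(\<Sum>i\<in>E. \<Sum>j\<in>E. \<Sum>k\<in>E. (p k i \<bullet> j)\<^sup>2) = a"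
      unfolding a_def by (rule sum_rotate[symmetric])
    also have "(\<Sum>i\<in>E. \<Sum>j\<in>E. \<Sum>k\<in>E. (p j k \<bullet> i) * (p k i \<bullet> j)) = b"
      using sum_rotate[of "\<lambda>j k i. (p j k \<bullet> i) * (p k i \<bullet> j)" E]
      by (simp add: cross b2)
    finally show ?thesis by simp
  qed
  also have "(\<Sum>i\<in>E. \<Sum>j\<in>E. N j (N i i) \<bullet> j) = (H \<bullet> H) / 4"
  proof -
    have half: "N i i = (1/2) *\<^sub>R p i i" for i
      by (simp flip: sym scaleR_2)
    have "(\<Sum>i\<in>E. \<Sum>j\<in>E. N j (N i i) \<bullet> j) = (\<Sum>i\<in>E. N i i) \<bullet> (\<Sum>j\<in>E. N j j)"
      unfolding inner_sum_left by (simp only: inner_sum_right adj[of _ "N i i" for i])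
    also have "(\<Sum>i\<in>E. N i i) = (1/2) *\<^sub>R H"
      unfolding half H_def by (simp add: scaleR_sum_right)
    finally show ?thesis by simp
  qed
  also have "(\<Sum>i\<in>E. \<Sum>j\<in>E. N (p i j) i \<bullet> j) = b - a / 2"
  proof -
    have "N (p i j) i \<bullet> j = (p i (p i j) \<bullet> j - p i j \<bullet> p i j + p j (p j i) \<bullet> i) / 2" for i j
      by (simp add: inner comm[of "p i j" i] comm[of j i])
    then have "(\<Sum>i\<in>E. \<Sum>j\<in>E. N (p i j) i \<bullet> j) = (b - a + b) / 2"
      by (simp only: sum.distrib sum_subtractf a2 flip: b b2 sum_divide_distrib)
    then show ?thesis by simp
  qed
  finally show ?thesis
    unfolding H a_def[symmetric] b_def[symmetric] by (simp add: field_simps)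
qed

theorem mainTheorem5:
  fixes p :: "'a::real_inner \<Rightarrow> 'a \<Rightarrow> 'a" and E :: "'a set"
  assumes "jordan_algebra p" and "orthonormal_basis E"
  shows "jordan_scalar_curvature p =
           - (1/4) * (\<Sum>i\<in>E. \<Sum>j\<in>E. \<Sum>k\<in>E. (p i j \<bullet> k)\<^sup>2)
           + (1/2) * (\<Sum>i\<in>E. killing_form p i i)
           - (1/4) * (mean_curvature p \<bullet> mean_curvature p) \<and>
         (nilpotent_algebra p \<longrightarrow>
           jordan_scalar_curvature p \<le> 0 \<and>
           (jordan_scalar_curvature p = 0 \<longleftrightarrow> (\<forall>x y. p x y = 0)))"
proof (intro conjI impI)
  note E = assms(2)
  have p: "bilinear p" and comm: "\<And>x y. p x y = p y x"
    using assms(1) by (auto simp: jordan_algebra_def)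
  have fin: "finite E"
    using E by (simp add: orthonormal_basis_def)
  let ?a = "\<Sum>i\<in>E. \<Sum>j\<in>E. \<Sum>k\<in>E. (p i j \<bullet> k)\<^sup>2"
  let ?h = "mean_curvature p \<bullet> mean_curvature p"
  show formula: "jordan_scalar_curvature p =
      - (1/4) * ?a + (1/2) * (\<Sum>i\<in>E. killing_form p i i) - (1/4) * ?h"
    by (rule jordan_scalar_curvature_formula[OF E p comm])
  have a_nonneg: "?a \<ge> 0"
    by (intro sum_nonneg) simp
  assume "nilpotent_algebra p"
  then have sc: "jordan_scalar_curvature p = - (1/4) * ?a - (1/4) * ?h"
    using formula killing_form_nilpotent[OF E p] by simp
  show "jordan_scalar_curvature p \<le> 0"
    using sc a_nonneg inner_ge_zero[of "mean_curvature p"] by linarith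
  show "jordan_scalar_curvature p = 0 \<longleftrightarrow> (\<forall>x y. p x y = 0)"
  proof
    assume "jordan_scalar_curvature p = 0"
    then have "?a = 0"
      using sc a_nonneg inner_ge_zero[of "mean_curvature p"] by linarith
    then have c: "p i j \<bullet> k = 0" if "i \<in> E" "j \<in> E" "k \<in> E" for i j k
      using fin that by (simp add: sum_nonneg_eq_0_iff sum_nonneg)
    have basis: "p i j = 0" if "i \<in> E" "j \<in> E" for i j
      using orthonormal_basis_expand[OF E, of "p i j"] c[OF that] by simp
    show "\<forall>x y. p x y = 0"
    proof (intro allI)
      fix x y
      have "bilinear (\<lambda>x y :: 'a. 0 :: 'a)"
        by (simp add: bilinear_def linear_iff)
      moreover have "UNIV \<subseteq> span E"
        using E by (simp add: orthonormal_basis_def)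
      ultimately show "p x y = 0"
        using bilinear_eq[OF p, of "\<lambda>x y. 0" UNIV E UNIV E x y] basis by simp
    qed
  next
    assume "\<forall>x y. p x y = 0"
    then show "jordan_scalar_curvature p = 0"
      using sc by (simp add: mean_curvature_def)
  qed
qed

end
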